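(* Let $M$ be a smooth compact manifold without boundary, of dimension $d\ge 1$. Fix $t>0$ and a smooth embedding $\iota:M\to\mathbb{R}^D$. Let $(g_1,p_1)$ and $(g_2,p_2)$ be such that each $g_i$ is a $C^2$ Riemannian metric on $M$ and each $p_i\in C(M)$ satisfies $p_i>0$ on $M$. Let $m_i:=p_i\,\mu_{g_i}$. Assume $$L^{\mathrm{ext}}_{t,p_1}(g_1;\iota)=L^{\mathrm{ext}}_{t,p_2}(g_2;\iota)\quad\text{as operators on }C(M).$$ Then $m_1=m_2$ (as Borel measures on $M$).
   Context: $C(M)$ denotes the space of continuous real-valued functions on $M$. For a Riemannian metric $g$ on $M$, $\mu_g$ denotes its Riemannian volume measure, and $p\,\mu_g$ denotes the measure with density $p$ with respect to $\mu_g$. For a smooth embedding $\iota:M\to\mathbb{R}^D$, a $C^2$ Riemannian metric $g$ on $M$ (not assumed to be induced by $\iota$), $t>0$, and $p\in C(M)$ with $p>0$, the extrinsic continuous graph Laplace operator is $$(L^{\mathrm{ext}}_{t,p}(g;\iota)f)(x):=\frac{1}{t^{\frac d2+1}}\int_M \exp\Big(-\frac{\|\iota(x)-\iota(y)\|^2}{t}\Big)\,\bigl(f(x)-f(y)\bigr)\,p(y)\,d\mu_g(y),\qquad f\in C(M),\ x\in M,$$ where $\|\cdot\|$ is the Euclidean norm on $\mathbb{R}^D$. *)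

theory Defs
  imports "HOL-Analysis.Analysis"
begin

text \<open>Only used for open \<open>S\<close> and finite-dimensional domains, where continuity of all
  iterated directional derivatives is the usual notion of class \<open>C\<^sup>k\<close>.\<close>

primrec Ck_on :: "nat \<Rightarrow> 'a::euclidean_space set \<Rightarrow> ('a \<Rightarrow> 'b::real_normed_vector) \<Rightarrow> bool" where
  "Ck_on 0 S f \<longleftrightarrow> continuous_on S f"
| "Ck_on (Suc k) S f \<longleftrightarrow>
     (\<forall>x\<in>S. f differentiable (at x)) \<and>
     (\<forall>v. Ck_on k S (\<lambda>x. frechet_derivative f (at x) v))"

definition smooth_on :: "'a::euclidean_space set \<Rightarrow> ('a \<Rightarrow> 'b::real_normed_vector) \<Rightarrow> bool" where
  "smooth_on S f \<longleftrightarrow> (\<forall>k. Ck_on k S f)"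

text \<open>The manifold is a whole type \<open>'m\<close>. A chart is a pair \<open>(U, \<phi>)\<close>; the values of \<open>\<phi>\<close>
  outside \<open>U\<close> are irrelevant, and its inverse is \<open>inv_into U \<phi>\<close>. Chart images are open in
  \<open>real ^ 'd\<close>, so there is no boundary and the dimension is \<open>CARD('d)\<close>.\<close>

type_synonym ('m, 'd) chart = "'m set \<times> ('m \<Rightarrow> (real, 'd) vec)"

definition is_chart :: "('m::topological_space, 'd::finite) chart \<Rightarrow> bool" where
  "is_chart c \<longleftrightarrow> (case c of (U, \<phi>) \<Rightarrow>
     open U \<and> open (\<phi> ` U) \<and> homeomorphism U (\<phi> ` U) \<phi> (inv_into U \<phi>))"

definition smooth_atlas :: "('m::{t2_space, second_countable_topology}, 'd::finite) chart set \<Rightarrow> bool"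
  where
  "smooth_atlas \<A> \<longleftrightarrow>
     (\<forall>c\<in>\<A>. is_chart c) \<and>
     (\<Union>(U, \<phi>)\<in>\<A>. U) = UNIV \<and>
     (\<forall>(U, \<phi>)\<in>\<A>. \<forall>(V, \<psi>)\<in>\<A>. smooth_on (\<phi> ` (U \<inter> V)) (\<psi> \<circ> inv_into U \<phi>))"

definition smooth_map ::
  "('m::topological_space, 'd::finite) chart set \<Rightarrow> ('m \<Rightarrow> 'b::real_normed_vector) \<Rightarrow> bool" where
  "smooth_map \<A> F \<longleftrightarrow> (\<forall>(U, \<phi>)\<in>\<A>. smooth_on (\<phi> ` U) (F \<circ> inv_into U \<phi>))"

definition smooth_embedding ::
  "('m::topological_space, 'd::finite) chart set \<Rightarrow> ('m \<Rightarrow> 'b::euclidean_space) \<Rightarrow> bool" where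
  "smooth_embedding \<A> \<iota> \<longleftrightarrow>
     smooth_map \<A> \<iota> \<and>
     (\<forall>(U, \<phi>)\<in>\<A>. \<forall>q\<in>U. inj (frechet_derivative (\<iota> \<circ> inv_into U \<phi>) (at (\<phi> q)))) \<and>
     embedding_map euclidean euclidean \<iota>"

text \<open>Tangent vectors at \<open>q\<close> are derivations at \<open>q\<close> of the algebra of smooth functions on the
  manifold. They are extended by \<open>0\<close> to non-smooth functions, so that equality of derivations
  is equality of HOL functions.\<close>

type_synonym 'm tangent = "('m \<Rightarrow> real) \<Rightarrow> real"

definition tangent_space ::
  "('m::topological_space, 'd::finite) chart set \<Rightarrow> 'm \<Rightarrow> 'm tangent set" where
  "tangent_space \<A> q = {X.
     (\<forall>f. \<not> smooth_map \<A> f \<longrightarrow> X f = 0) \<and>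
     (\<forall>f h a b. smooth_map \<A> f \<longrightarrow> smooth_map \<A> h \<longrightarrow>
        X (\<lambda>y. a * f y + b * h y) = a * X f + b * X h) \<and>
     (\<forall>f h. smooth_map \<A> f \<longrightarrow> smooth_map \<A> h \<longrightarrow>
        X (\<lambda>y. f y * h y) = f q * X h + h q * X f)}"

definition coord_vector ::
  "('m::topological_space, 'd::finite) chart set \<Rightarrow> ('m, 'd) chart \<Rightarrow> 'd \<Rightarrow> 'm \<Rightarrow> 'm tangent" where
  "coord_vector \<A> c i q = (case c of (U, \<phi>) \<Rightarrow> (\<lambda>f.
     if smooth_map \<A> f
     then frechet_derivative (f \<circ> inv_into U \<phi>) (at (\<phi> q)) (axis i 1) else 0))"

text \<open>A metric assigns to each point a bilinear form; its values on arguments outside the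
  tangent space are irrelevant.\<close>

type_synonym 'm metric = "'m \<Rightarrow> 'm tangent \<Rightarrow> 'm tangent \<Rightarrow> real"

definition gram_matrix ::
  "('m::topological_space, 'd::finite) chart set \<Rightarrow> 'm metric \<Rightarrow> ('m, 'd) chart \<Rightarrow> 'm \<Rightarrow> real ^ 'd ^ 'd"
  where
  "gram_matrix \<A> g c q = (\<chi> i j. g q (coord_vector \<A> c i q) (coord_vector \<A> c j q))"

definition inner_product_on_tangent ::
  "'m tangent set \<Rightarrow> ('m tangent \<Rightarrow> 'm tangent \<Rightarrow> real) \<Rightarrow> bool" where
  "inner_product_on_tangent T B \<longleftrightarrow>
     (\<forall>X\<in>T. \<forall>Y\<in>T. B X Y = B Y X) \<and>
     (\<forall>X\<in>T. \<forall>Y\<in>T. \<forall>Z\<in>T. \<forall>a b. B (\<lambda>f. a * X f + b * Y f) Z = a * B X Z + b * B Y Z) \<and>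
     (\<forall>X\<in>T. X \<noteq> (\<lambda>f. 0) \<longrightarrow> B X X > 0)"

definition C2_riemannian_metric ::
  "('m::topological_space, 'd::finite) chart set \<Rightarrow> 'm metric \<Rightarrow> bool" where
  "C2_riemannian_metric \<A> g \<longleftrightarrow>
     (\<forall>q. inner_product_on_tangent (tangent_space \<A> q) (g q)) \<and>
     (\<forall>(U, \<phi>)\<in>\<A>. \<forall>i j.
        Ck_on 2 (\<phi> ` U) (\<lambda>x. gram_matrix \<A> g (U, \<phi>) (inv_into U \<phi> x) $ i $ j))"

text \<open>The unique Borel measure that in every chart is given by \<open>sqrt (det g\<^sub>i\<^sub>j) dx\<close>.\<close>

definition riemannian_volume ::
  "('m::topological_space, 'd::finite) chart set \<Rightarrow> 'm metric \<Rightarrow> 'm measure" where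
  "riemannian_volume \<A> g = (THE \<mu>. sets \<mu> = sets borel \<and>
     (\<forall>(U, \<phi>)\<in>\<A>. \<forall>S\<in>sets borel. S \<subseteq> U \<longrightarrow>
        emeasure \<mu> S =
          (\<integral>\<^sup>+ x. ennreal (sqrt (det (gram_matrix \<A> g (U, \<phi>) (inv_into U \<phi> x))))
                * indicator (\<phi> ` S) x \<partial>lborel)))"

definition ext_graph_laplace ::
  "('m::topological_space, 'd::finite) chart set \<Rightarrow> real \<Rightarrow> ('m \<Rightarrow> real) \<Rightarrow> 'm metric \<Rightarrow>
   ('m \<Rightarrow> 'b::euclidean_space) \<Rightarrow> ('m \<Rightarrow> real) \<Rightarrow> 'm \<Rightarrow> real" where
  "ext_graph_laplace \<A> t p g \<iota> f x =
     1 / t powr (real CARD('d) / 2 + 1) *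
     (\<integral>y. exp (- ((norm (\<iota> x - \<iota> y))\<^sup>2 / t)) * (f x - f y) * p y \<partial>(riemannian_volume \<A> g))"

end

theory Submission
  imports Defs
begin

text \<open>
  The two operators are compared at a single point \<open>x\<^sub>0\<close>. Write \<open>k y = exp (- \<parallel>\<iota> x\<^sub>0 - \<iota> y\<parallel>\<^sup>2 / t)\<close>,
  which is continuous and positive. For a continuous function \<open>f\<close> with \<open>f x\<^sub>0 = 0\<close>, the value of the
  operator at \<open>x\<^sub>0\<close> is, up to a non-zero constant, the integral of \<open>f\<close> against the finite measure
  \<open>k m\<close>. So \<open>k m\<^sub>1\<close> and \<open>k m\<^sub>2\<close> have the same integrals of all continuous functions vanishing at
  \<open>x\<^sub>0\<close>, which forces them to agree away from \<open>x\<^sub>0\<close>; since the dimension is at least one, a Riemannian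
  volume has no atoms, so they agree everywhere
  (\<open>measure_eq_of_integrals_vanishing_at_point\<close>). Dividing by \<open>k > 0\<close> gives \<open>m\<^sub>1 = m\<^sub>2\<close>. The
  test functions are built from the distance, in the ambient space, to the image of a closed set
  under the continuous injection \<open>\<iota>\<close>.

  The argument needs that the Riemannian volume is a Borel measure, finite on a compact manifold
  and without atoms. These properties can be read off its coordinate expression once it is known
  that exactly one Borel measure has that expression in every chart
  (\<open>riemannian_volume_characterization\<close>). Uniqueness and the construction both come from a countable
  partition of the manifold into Borel pieces, each lying in one chart. That the constructed measure
  has the right expression in all other charts is the change-of-variables formula, combined with the
  transformation law of the Gram matrix under a transition map, \<open>G \<mapsto> J\<^sup>T G J\<close>, which turns
  \<open>sqrt (det G)\<close> into \<open>\<bar>det J\<bar> sqrt (det G)\<close>. The law follows from the chain rule, because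
  coordinate vectors are derivations and the metric is bilinear on them.
\<close>

section \<open>Change of variables for non-negative integrals\<close>

text \<open>The change-of-variables theorem concerns \<open>real ^ 'm\<close> with a finite, well-ordered index type \<open>'m\<close>,
  whereas coordinates on a manifold are indexed by an arbitrary finite type. This type is an initial
  segment of the natural numbers, hence well-ordered, of the same size as \<open>'a\<close>; relabelling
  coordinates along a bijection preserves both Lebesgue measure and determinants.\<close>

typedef 'a ordered_index = "{..<CARD('a::finite)}"
  by (auto intro!: exI[of _ 0])

instance ordered_index :: (finite) finite
proof
  show "finite (UNIV :: 'a ordered_index set)"
    using type_definition.univ[OF type_definition_ordered_index] by (metis finite_imageI finite_lessThan)
qed

instantiation ordered_index :: (finite) wellorder
begin

definition less_eq_ordered_index :: "'a ordered_index \<Rightarrow> 'a ordered_index \<Rightarrow> bool" where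
  "less_eq_ordered_index i j \<longleftrightarrow> Rep_ordered_index i \<le> Rep_ordered_index j"

definition less_ordered_index :: "'a ordered_index \<Rightarrow> 'a ordered_index \<Rightarrow> bool" where
  "less_ordered_index i j \<longleftrightarrow> Rep_ordered_index i < Rep_ordered_index j"

instance
proof
  fix P :: "'a ordered_index \<Rightarrow> bool" and a :: "'a ordered_index"
  assume *: "\<And>x. (\<And>y. y < x \<Longrightarrow> P y) \<Longrightarrow> P x"
  have "\<And>x :: 'a ordered_index. Rep_ordered_index x = n \<Longrightarrow> P x" for n
    by (induction n rule: less_induct) (use * less_ordered_index_def in blast)
  then show "P a" by blast
qed (auto simp: less_eq_ordered_index_def less_ordered_index_def Rep_ordered_index_inject)

end

lemma ex_bij_ordered_index: "\<exists>h :: 'd::finite ordered_index \<Rightarrow> 'd. bij h"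
proof -
  have "CARD('d ordered_index) = CARD('d)"
    using type_definition.card[OF type_definition_ordered_index[where 'a='d]] by simp
  then show ?thesis
    by (intro finite_same_card_bij) auto
qed

text \<open>Conjugating a permutation by a bijection of index types preserves its sign, so the two Leibniz
  expansions agree term by term.\<close>

lemma det_reindex:
  fixes A :: "real ^ 'd ^ 'd" and h :: "'m::finite \<Rightarrow> 'd::finite"
  assumes h: "bij h"
  shows "det (\<chi> i j. A $ h i $ h j) = det A"
proof -
  let ?F = "map_permutation UNIV h"
  have hh: "bij_betw h UNIV UNIV" "inj_on h UNIV" "surj h" "inj h" using h by (auto simp: bij_def)
  have F: "?F p = h \<circ> p \<circ> inv h" for p
    by (auto simp: map_permutation_def restrict_id_def fun_eq_iff hh)
  have bij: "bij_betw ?F {p. p permutes UNIV} {p. p permutes UNIV}"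
    using bij_betw_permutations[OF hh(1)] by (simp add: F[abs_def] o_def)
  have "det A = (\<Sum>p\<in>{p. p permutes UNIV}. of_int (sign (?F p)) * (\<Prod>i\<in>UNIV. A $ i $ ?F p i))"
    unfolding det_def by (rule sum.reindex_bij_betw[OF bij, symmetric])
  also have "\<dots> = (\<Sum>p\<in>{p. p permutes UNIV}. of_int (sign p) * (\<Prod>i\<in>UNIV. A $ h i $ h (p i)))"
  proof (intro sum.cong refl arg_cong2[where f="(*)"])
    fix p :: "'m \<Rightarrow> 'm" assume "p \<in> {p. p permutes UNIV}"
    then show "(of_int (sign (?F p)) :: real) = of_int (sign p)"
      by (subst sign_map_permutation) (use hh in auto)
    have "(\<Prod>i\<in>UNIV. A $ i $ ?F p i) = (\<Prod>i\<in>UNIV. A $ h i $ ?F p (h i))"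
      by (rule prod.reindex_bij_betw[OF hh(1), symmetric])
    also have "\<dots> = (\<Prod>i\<in>UNIV. A $ h i $ h (p i))"
      by (simp add: F hh)
    finally show "(\<Prod>i\<in>UNIV. A $ i $ ?F p i) = (\<Prod>i\<in>UNIV. A $ h i $ h (p i))" .
  qed
  also have "\<dots> = det (\<chi> i j. A $ h i $ h j)"
    unfolding det_def by simp
  finally show ?thesis ..
qed

lemma lborel_reindex:
  fixes h :: "'m::finite \<Rightarrow> 'd::finite"
  assumes h: "bij h"
  shows "distr lborel borel (\<lambda>x :: real^'d. \<chi> i. x $ h i) = (lborel :: (real^'m) measure)"
proof (rule lborel_eqI[symmetric])
  let ?R = "\<lambda>x :: real^'d. \<chi> i. x $ h i"
  have [measurable]: "?R \<in> borel \<rightarrow>\<^sub>M borel"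
    by (intro borel_measurable_continuous_onI continuous_intros)
  fix l u :: "real^'m"
  assume "\<And>b. b \<in> Basis \<Longrightarrow> l \<bullet> b \<le> u \<bullet> b"
  then have le: "l $ i \<le> u $ i" for i
    by (simp add: cart_eq_inner_axis axis_in_Basis_iff)
  define l' where "l' = (\<chi> j. l $ inv h j)"
  define u' where "u' = (\<chi> j. u $ inv h j)"
  have surj: "h (inv h j) = j" "inv h (h i) = i" for i j
    using h by (auto simp: bij_def surj_f_inv_f)
  have pre: "?R -` box l u = box l' u'"
    unfolding l'_def u'_def by (auto simp: mem_box_cart) (metis surj)+
  have "emeasure (distr lborel borel ?R) (box l u) = emeasure lborel (box l' u')"
    by (subst emeasure_distr) (auto simp: pre)
  also have "\<dots> = ennreal (\<Prod>b\<in>Basis. (u' - l') \<bullet> b)"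
    using le by (subst emeasure_lborel_box) (auto simp: l'_def u'_def Basis_vec_def inner_axis)
  also have "(\<Prod>b\<in>Basis. (u' - l') \<bullet> b) = (\<Prod>j\<in>UNIV. (u' - l') $ j)"
    by (simp add: Basis_vec_def UNION_singleton_eq_range prod.reindex inj_on_def axis_eq_axis inner_axis)
  also have "\<dots> = (\<Prod>i\<in>UNIV. (u' - l') $ h i)"
    by (rule prod.reindex_bij_betw[symmetric]) (use h in auto)
  also have "\<dots> = (\<Prod>i\<in>UNIV. (u - l) $ i)"
    by (simp add: l'_def u'_def surj)
  also have "\<dots> = (\<Prod>b\<in>Basis. (u - l) \<bullet> b)"
    by (simp add: Basis_vec_def UNION_singleton_eq_range prod.reindex inj_on_def axis_eq_axis inner_axis)
  finally show "emeasure (distr lborel borel ?R) (box l u) = ennreal (\<Prod>b\<in>Basis. (u - l) \<bullet> b)" .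
qed auto

text \<open>The bridge between the two integrals: it lets a failure of absolute integrability be read as an
  infinite value of the non-negative integral.\<close>

lemma absolutely_integrable_of_nn_integral_finite:
  fixes f :: "'a::euclidean_space \<Rightarrow> real"
  assumes meas: "(\<lambda>x. indicator S x * f x) \<in> borel_measurable borel"
    and nonneg: "\<And>x. x \<in> S \<Longrightarrow> 0 \<le> f x"
    and fin: "(\<integral>\<^sup>+ x. ennreal (f x) * indicator S x \<partial>lborel) \<noteq> \<infinity>"
  shows "f absolutely_integrable_on S"
proof -
  have "integrable lborel (\<lambda>x. indicator S x * f x)"
  proof (rule integrableI_nonneg)
    show "AE x in lborel. 0 \<le> indicator S x * f x"
      using nonneg by (auto simp: indicator_def)
    have "(\<integral>\<^sup>+ x. ennreal (indicator S x * f x) \<partial>lborel) = (\<integral>\<^sup>+ x. ennreal (f x) * indicator S x \<partial>lborel)"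
      by (intro nn_integral_cong) (auto simp: indicator_def)
    then show "(\<integral>\<^sup>+ x. ennreal (indicator S x * f x) \<partial>lborel) < \<infinity>"
      using fin by (simp add: top.not_eq_extremum)
  qed (use meas in simp)
  then have "integrable lebesgue (\<lambda>x. indicator S x * f x)"
    by (rule integrable_completion[THEN iffD2, rotated]) (use meas in simp)
  then show ?thesis
    by (simp add: set_integrable_def)
qed

text \<open>Absolute integrability of one side is equivalent to that of the other. If it holds, both sides are
  the same absolutely convergent integral; if it fails, both are infinite because the integrands
  are measurable and non-negative. Asking for \<open>u\<close> only on \<open>S\<close> permits any measurable
  representative of the transformed density.\<close>

lemma nn_integral_change_of_variables_wellorder:
  fixes T :: "real^'m::{finite,wellorder} \<Rightarrow> real^'m::_" and f u :: "real^'m::_ \<Rightarrow> real"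
  assumes S: "S \<in> sets borel"
    and deriv: "\<And>x. x \<in> S \<Longrightarrow> (T has_derivative T' x) (at x within S)"
    and inj: "inj_on T S"
    and u: "\<And>x. x \<in> S \<Longrightarrow> u x = \<bar>det (matrix (T' x))\<bar> * f (T x)"
    and nonneg: "\<And>y. y \<in> T ` S \<Longrightarrow> 0 \<le> f y"
    and meas_f: "(\<lambda>y. indicator (T ` S) y * f y) \<in> borel_measurable borel"
    and meas_u: "(\<lambda>x. indicator S x * u x) \<in> borel_measurable borel"
  shows "(\<integral>\<^sup>+ y. ennreal (f y) * indicator (T ` S) y \<partial>lborel) =
         (\<integral>\<^sup>+ x. ennreal (u x) * indicator S x \<partial>lborel)"
proof -
  \<comment> \<open>The theorem is stated for vector-valued integrands, hence the one-dimensional wrapping.\<close>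
  have "(\<lambda>x. \<bar>det (matrix (T' x))\<bar> *\<^sub>R (\<chi> i::1. f (T x))) absolutely_integrable_on S \<and>
          integral S (\<lambda>x. \<bar>det (matrix (T' x))\<bar> *\<^sub>R (\<chi> i::1. f (T x))) = (\<chi> i. b)
     \<longleftrightarrow> (\<lambda>y. \<chi> i::1. f y) absolutely_integrable_on (T ` S) \<and>
          integral (T ` S) (\<lambda>y. \<chi> i::1. f y) = (\<chi> i. b)" for b
    by (rule has_absolute_integral_change_of_variables[OF _ deriv inj]) (use S in auto)
  then have "(\<lambda>x. \<bar>det (matrix (T' x))\<bar> * f (T x)) absolutely_integrable_on S \<and>
          integral S (\<lambda>x. \<bar>det (matrix (T' x))\<bar> * f (T x)) = b
     \<longleftrightarrow> f absolutely_integrable_on (T ` S) \<and> integral (T ` S) f = b" for b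
    by (simp add: absolutely_integrable_on_1_iff integral_on_1_eq vec_eq_iff)
  moreover have "(\<lambda>x. \<bar>det (matrix (T' x))\<bar> * f (T x)) absolutely_integrable_on S
      \<longleftrightarrow> u absolutely_integrable_on S"
    using u by (intro set_integrable_cong) auto
  moreover have "integral S (\<lambda>x. \<bar>det (matrix (T' x))\<bar> * f (T x)) = integral S u"
    using u by (intro integral_cong) auto
  ultimately have cov: "u absolutely_integrable_on S \<and> integral S u = b
     \<longleftrightarrow> f absolutely_integrable_on (T ` S) \<and> integral (T ` S) f = b" for b
    by simp
  have nonneg_u: "0 \<le> u x" if "x \<in> S" for x
    using that u nonneg by auto
  show ?thesis
  proof (cases "u absolutely_integrable_on S")
    case True
    then have "f absolutely_integrable_on (T ` S)" "integral (T ` S) f = integral S u"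
      using cov by auto
    then have "(u has_integral integral S u) S" "(f has_integral integral S u) (T ` S)"
      using True by (metis absolutely_integrable_on_def integrable_integral)+
    then show ?thesis
      using nonneg nonneg_u by (simp add: nn_integral_has_integral_lebesgue')
  next
    case False
    then have "\<not> f absolutely_integrable_on (T ` S)" using cov by auto
    then show ?thesis
      using False absolutely_integrable_of_nn_integral_finite[OF meas_f nonneg]
        absolutely_integrable_of_nn_integral_finite[OF meas_u nonneg_u] by metis
  qed
qed

text \<open>Conjugating with the relabelling of coordinates reduces this to well-ordered index types. A
  function of arbitrary sign reduces to its positive part, since \<open>ennreal\<close> maps negative reals to
  zero and multiplication by \<open>\<bar>det\<bar>\<close> commutes with taking positive parts.\<close>

lemma nn_integral_change_of_variables:
  fixes T :: "real^'d \<Rightarrow> real^'d" and f u :: "real^'d \<Rightarrow> real"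
  assumes S: "S \<in> sets borel"
    and deriv: "\<And>x. x \<in> S \<Longrightarrow> (T has_derivative T' x) (at x within S)"
    and inj: "inj_on T S"
    and u: "\<And>x. x \<in> S \<Longrightarrow> u x = \<bar>det (matrix (T' x))\<bar> * f (T x)"
    and meas_f: "(\<lambda>y. indicator (T ` S) y * f y) \<in> borel_measurable borel"
    and meas_u: "(\<lambda>x. indicator S x * u x) \<in> borel_measurable borel"
  shows "(\<integral>\<^sup>+ y. ennreal (f y) * indicator (T ` S) y \<partial>lborel) =
         (\<integral>\<^sup>+ x. ennreal (u x) * indicator S x \<partial>lborel)"
proof -
  obtain h :: "'d ordered_index \<Rightarrow> 'd" where h: "bij h"
    using ex_bij_ordered_index by blast
  have hh: "h (inv h j) = j" "inv h (h i) = i" for i j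
    using h by (auto simp: bij_def surj_f_inv_f)
  define R :: "real^'d \<Rightarrow> real^'d ordered_index" where "R = (\<lambda>x. \<chi> i. x $ h i)"
  define Q :: "real^'d ordered_index \<Rightarrow> real^'d" where "Q = (\<lambda>x. \<chi> j. x $ inv h j)"
  have RQ [simp]: "R (Q y) = y" "Q (R x) = x" for x y
    by (simp_all add: R_def Q_def vec_eq_iff hh)
  have lin: "bounded_linear R" "bounded_linear Q"
    unfolding R_def Q_def by (auto intro!: linear_conv_bounded_linear[THEN iffD1] linearI simp: vec_eq_iff)
  have [measurable]: "R \<in> borel \<rightarrow>\<^sub>M borel" "Q \<in> borel \<rightarrow>\<^sub>M borel"
    using lin by (auto intro!: borel_measurable_continuous_onI linear_continuous_on)
  have image_R: "R ` X = Q -` X" for X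
    by (auto intro!: image_eqI[where x="Q _"])
  have ind: "indicator (R ` X) y = (indicator X (Q y) :: 'c::zero_neq_one)" for X y
    by (simp add: image_R indicator_def)
  define T1 where "T1 = R \<circ> T \<circ> Q"
  have T1_image: "T1 ` (R ` S) = R ` (T ` S)"
    by (auto simp: T1_def image_image)
  have transfer: "(\<integral>\<^sup>+ y. ennreal (w (Q y)) * indicator (R ` X) y \<partial>lborel) =
      (\<integral>\<^sup>+ x. ennreal (w x) * indicator X x \<partial>lborel)"
    if "(\<lambda>x. indicator X x * w x) \<in> borel_measurable borel" for w :: "real^'d \<Rightarrow> real" and X
  proof -
    note that[measurable]
    have "(\<integral>\<^sup>+ y. ennreal (w (Q y)) * indicator (R ` X) y \<partial>lborel) =
        (\<integral>\<^sup>+ y. ennreal (indicator X (Q y) * w (Q y)) \<partial>distr lborel borel R)"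
      unfolding lborel_reindex[OF h, folded R_def] ind
      by (intro nn_integral_cong) (auto simp: indicator_def)
    also have "\<dots> = (\<integral>\<^sup>+ x. ennreal (indicator X x * w x) \<partial>lborel)"
      by (subst nn_integral_distr) (auto intro!: measurable_compose[OF _ that])
    also have "\<dots> = (\<integral>\<^sup>+ x. ennreal (w x) * indicator X x \<partial>lborel)"
      by (intro nn_integral_cong) (auto simp: indicator_def)
    finally show ?thesis .
  qed
  have pos: "indicator X y * max 0 r = max 0 (indicator X y * r)" for X :: "'c set" and y and r :: real
    by (auto simp: indicator_def)
  have "(\<integral>\<^sup>+ y. ennreal (max 0 (f (Q y))) * indicator (T1 ` (R ` S)) y \<partial>lborel) =
        (\<integral>\<^sup>+ x. ennreal (max 0 (u (Q x))) * indicator (R ` S) x \<partial>lborel)"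
  proof (rule nn_integral_change_of_variables_wellorder[where T' = "\<lambda>y. R \<circ> T' (Q y) \<circ> Q"])
    show "R ` S \<in> sets borel"
      unfolding image_R using measurable_sets[of Q borel borel S] S by simp
    show "inj_on T1 (R ` S)"
      using inj by (auto simp: T1_def inj_on_def) (metis RQ)
    show "(T1 has_derivative R \<circ> T' (Q y) \<circ> Q) (at y within R ` S)" if y: "y \<in> R ` S" for y
    proof -
      have "Q ` (R ` S) = S" by (simp add: image_image)
      moreover have "Q y \<in> S" using y by auto
      ultimately have "(T has_derivative T' (Q y)) (at (Q y) within Q ` (R ` S))"
        using deriv by simp
      from diff_chain_within[OF bounded_linear_imp_has_derivative[OF lin(2)] this]
      have "(T \<circ> Q has_derivative T' (Q y) \<circ> Q) (at y within R ` S)" .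
      from diff_chain_within[OF this bounded_linear_imp_has_derivative[OF lin(1)]]
      show ?thesis by (simp add: T1_def comp_assoc)
    qed
    show "max 0 (u (Q y)) = \<bar>det (matrix (R \<circ> T' (Q y) \<circ> Q))\<bar> * max 0 (f (Q (T1 y)))" if "y \<in> R ` S" for y
    proof -
      have Qax: "Q (axis j 1) = axis (h j) 1" for j
        by (auto simp: Q_def vec_eq_iff axis_def hh)
      have "matrix (R \<circ> T' (Q y) \<circ> Q) = (\<chi> i j. matrix (T' (Q y)) $ h i $ h j)"
        by (simp add: matrix_def vec_eq_iff Qax) (simp add: R_def)
      then have "det (matrix (R \<circ> T' (Q y) \<circ> Q)) = det (matrix (T' (Q y)))"
        using det_reindex[OF h] by simp
      then show ?thesis using u[of "Q y"] that by (auto simp: T1_def max_mult_distrib_left)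
    qed
    show "(\<lambda>y. indicator (T1 ` (R ` S)) y * max 0 (f (Q y))) \<in> borel_measurable borel"
      unfolding T1_image ind pos using measurable_compose[OF _ meas_f, of Q] by simp
    show "(\<lambda>y. indicator (R ` S) y * max 0 (u (Q y))) \<in> borel_measurable borel"
      unfolding ind pos using measurable_compose[OF _ meas_u, of Q] by simp
  qed simp
  then show ?thesis
    using transfer[OF meas_f] transfer[OF meas_u] by (simp add: T1_image ennreal_max_0)
qed

section \<open>Functions of class \<open>C\<^sup>k\<close>\<close>

text \<open>Openness of \<open>S\<close> matters: the derivative at a point of \<open>S\<close> depends only on the values on \<open>S\<close>, so the
  derivative formulas below, which hold only on \<open>S\<close>, may replace the derivative itself in the
  inductions.\<close>

lemma Ck_on_cong_open:
  assumes "open S" "Ck_on k S f" "\<And>x. x \<in> S \<Longrightarrow> f x = g x"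
  shows "Ck_on k S g"
  using assms(2,3)
proof (induction k arbitrary: f g)
  case 0
  then show ?case by (simp cong: continuous_on_cong)
next
  case (Suc k)
  have g: "(g has_derivative frechet_derivative f (at x)) (at x)" if "x \<in> S" for x
  proof (rule has_derivative_transform_within_open[OF _ \<open>open S\<close> that])
    show "(f has_derivative frechet_derivative f (at x)) (at x)"
      using Suc.prems(1) that by (simp add: frechet_derivative_works[symmetric])
  qed (use Suc.prems in auto)
  have "Ck_on k S (\<lambda>x. frechet_derivative g (at x) v)" for v
  proof (rule Suc.IH)
    show "Ck_on k S (\<lambda>x. frechet_derivative f (at x) v)"
      using Suc.prems(1) by simp
  qed (simp add: frechet_derivative_at[OF g, symmetric])
  moreover have "g differentiable (at x)" if "x \<in> S" for x
    using g[OF that] unfolding differentiable_def by blast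
  ultimately show ?case by simp
qed

lemma Ck_on_SucD: "Ck_on (Suc k) S f \<Longrightarrow> Ck_on k S f"
proof (induction k arbitrary: f)
  case 0
  then show ?case
    by (auto intro!: continuous_at_imp_continuous_on differentiable_imp_continuous_within)
next
  case (Suc k)
  then show ?case
    using Suc.IH Ck_on.simps(2)[of "Suc k" S f] Ck_on.simps(2)[of k S f] by blast
qed

lemma Ck_on_lincomb:
  fixes f h :: "'a::euclidean_space \<Rightarrow> real"
  assumes "open S" "Ck_on k S f" "Ck_on k S h"
  shows "Ck_on k S (\<lambda>x. a * f x + b * h x)"
  using assms(2,3)
proof (induction k arbitrary: f h)
  case 0
  then show ?case by (auto intro!: continuous_intros)
next
  case (Suc k)
  have der: "((\<lambda>x. a * f x + b * h x) has_derivative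
      (\<lambda>v. a * frechet_derivative f (at x) v + b * frechet_derivative h (at x) v)) (at x)"
    if "x \<in> S" for x
    using Suc.prems that by (auto intro!: derivative_eq_intros simp: frechet_derivative_works)
  have "Ck_on k S (\<lambda>x. frechet_derivative (\<lambda>x. a * f x + b * h x) (at x) v)" for v
  proof (rule Ck_on_cong_open[OF \<open>open S\<close>])
    show "Ck_on k S (\<lambda>x. a * frechet_derivative f (at x) v + b * frechet_derivative h (at x) v)"
      using Suc.prems by (intro Suc.IH) auto
  qed (simp add: frechet_derivative_at[OF der, symmetric])
  moreover have "(\<lambda>x. a * f x + b * h x) differentiable (at x)" if "x \<in> S" for x
    using der[OF that] unfolding differentiable_def by blast
  ultimately show ?case by simp
qed

lemma Ck_on_mult:
  fixes f h :: "'a::euclidean_space \<Rightarrow> real"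
  assumes "open S" "Ck_on k S f" "Ck_on k S h"
  shows "Ck_on k S (\<lambda>x. f x * h x)"
  using assms(2,3)
proof (induction k arbitrary: f h)
  case 0
  then show ?case by (auto intro!: continuous_intros)
next
  case (Suc k)
  have der: "((\<lambda>x. f x * h x) has_derivative
      (\<lambda>v. f x * frechet_derivative h (at x) v + frechet_derivative f (at x) v * h x)) (at x)"
    if "x \<in> S" for x
    using Suc.prems that by (auto intro!: derivative_eq_intros simp: frechet_derivative_works)
  have "Ck_on k S (\<lambda>x. frechet_derivative (\<lambda>x. f x * h x) (at x) v)" for v
  proof (rule Ck_on_cong_open[OF \<open>open S\<close>])
    have "Ck_on k S (\<lambda>x. f x * frechet_derivative h (at x) v)"
      "Ck_on k S (\<lambda>x. frechet_derivative f (at x) v * h x)"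
      using Suc.prems Ck_on_SucD[OF Suc.prems(1)] Ck_on_SucD[OF Suc.prems(2)]
      by (auto intro!: Suc.IH)
    from Ck_on_lincomb[OF \<open>open S\<close> this, of 1 1]
    show "Ck_on k S (\<lambda>x. f x * frechet_derivative h (at x) v + frechet_derivative f (at x) v * h x)"
      by simp
  qed (simp add: frechet_derivative_at[OF der, symmetric])
  moreover have "(\<lambda>x. f x * h x) differentiable (at x)" if "x \<in> S" for x
    using der[OF that] unfolding differentiable_def by blast
  ultimately show ?case by simp
qed

section \<open>Charts and smooth functions\<close>

lemma smooth_on_differentiable: "smooth_on S f \<Longrightarrow> x \<in> S \<Longrightarrow> f differentiable (at x)"
  using Ck_on.simps(2)[of 0 S f] by (auto simp: smooth_on_def)

lemma smooth_atlas_chartD: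
  assumes "smooth_atlas \<A>" "(U, \<phi>) \<in> \<A>"
  shows "open U" "open (\<phi> ` U)" "continuous_on U \<phi>" "continuous_on (\<phi> ` U) (inv_into U \<phi>)" "inj_on \<phi> U"
proof -
  have "is_chart (U, \<phi>)"
    using assms by (auto simp: smooth_atlas_def)
  then have *: "open U" "open (\<phi> ` U)" "homeomorphism U (\<phi> ` U) \<phi> (inv_into U \<phi>)"
    by (auto simp: is_chart_def)
  then show "open U" "open (\<phi> ` U)" "continuous_on U \<phi>" "continuous_on (\<phi> ` U) (inv_into U \<phi>)"
    by (auto simp: homeomorphism_def)
  show "inj_on \<phi> U"
    using *(3) unfolding homeomorphism_def by (intro inj_on_inverseI[where g="inv_into U \<phi>"]) auto
qed

lemma smooth_atlas_cover: "smooth_atlas \<A> \<Longrightarrow> \<Union>(fst ` \<A>) = UNIV"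
  by (auto simp: smooth_atlas_def case_prod_beta)

lemma smooth_atlas_transition:
  assumes "smooth_atlas \<A>" "(U, \<phi>) \<in> \<A>" "(V, \<psi>) \<in> \<A>"
  shows "smooth_on (\<phi> ` (U \<inter> V)) (\<psi> \<circ> inv_into U \<phi>)"
  using assms unfolding smooth_atlas_def by blast

lemma chart_image_open:
  assumes "smooth_atlas \<A>" "(U, \<phi>) \<in> \<A>" "open W" "W \<subseteq> U"
  shows "open (\<phi> ` W)"
proof -
  note c = smooth_atlas_chartD[OF assms(1,2)]
  have "\<phi> ` W = \<phi> ` U \<inter> inv_into U \<phi> -` W"
    using assms(4) c(5) by (auto simp: subset_iff)
  then show ?thesis
    using continuous_open_preimage[OF c(4,2) assms(3)] by simp
qed

lemma smooth_map_has_derivative: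
  assumes "smooth_map \<A> f" "(U, \<phi>) \<in> \<A>" "q \<in> U"
  shows "(f \<circ> inv_into U \<phi> has_derivative frechet_derivative (f \<circ> inv_into U \<phi>) (at (\<phi> q))) (at (\<phi> q))"
  using assms unfolding smooth_map_def frechet_derivative_works[symmetric]
  by (blast intro: smooth_on_differentiable)

lemma smooth_map_lincomb:
  fixes f h :: "'m::{t2_space, second_countable_topology} \<Rightarrow> real"
  assumes \<A>: "smooth_atlas \<A>" and f: "smooth_map \<A> f" and h: "smooth_map \<A> h"
  shows "smooth_map \<A> (\<lambda>y. a * f y + b * h y)"
  unfolding smooth_map_def smooth_on_def
proof safe
  fix U \<phi> k assume c: "(U, \<phi>) \<in> \<A>"
  have "Ck_on k (\<phi> ` U) (\<lambda>x. a * (f \<circ> inv_into U \<phi>) x + b * (h \<circ> inv_into U \<phi>) x)"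
    using c f h smooth_atlas_chartD(2)[OF \<A> c]
    unfolding smooth_map_def smooth_on_def by (intro Ck_on_lincomb) blast+
  then show "Ck_on k (\<phi> ` U) ((\<lambda>y. a * f y + b * h y) \<circ> inv_into U \<phi>)"
    by (simp add: o_def)
qed

lemma smooth_map_mult:
  fixes f h :: "'m::{t2_space, second_countable_topology} \<Rightarrow> real"
  assumes \<A>: "smooth_atlas \<A>" and f: "smooth_map \<A> f" and h: "smooth_map \<A> h"
  shows "smooth_map \<A> (\<lambda>y. f y * h y)"
  unfolding smooth_map_def smooth_on_def
proof safe
  fix U \<phi> k assume c: "(U, \<phi>) \<in> \<A>"
  have "Ck_on k (\<phi> ` U) (\<lambda>x. (f \<circ> inv_into U \<phi>) x * (h \<circ> inv_into U \<phi>) x)"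
    using c f h smooth_atlas_chartD(2)[OF \<A> c]
    unfolding smooth_map_def smooth_on_def by (intro Ck_on_mult) blast+
  then show "Ck_on k (\<phi> ` U) ((\<lambda>y. f y * h y) \<circ> inv_into U \<phi>)"
    by (simp add: o_def)
qed

section \<open>Coordinate vectors and Gram matrices under a change of chart\<close>

text \<open>Closure of smooth functions under linear combinations and products is needed here because a
  derivation is set to zero on non-smooth functions: linearity and the Leibniz rule would fail if
  a combination of smooth functions could be non-smooth.\<close>

lemma coord_vector_in_tangent_space:
  fixes \<A> :: "('m::{t2_space, second_countable_topology}, 'd::finite) chart set"
  assumes \<A>: "smooth_atlas \<A>" and c: "(U, \<phi>) \<in> \<A>" and q: "q \<in> U"
  shows "coord_vector \<A> (U, \<phi>) i q \<in> tangent_space \<A> q"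
proof -
  let ?D = "\<lambda>f. frechet_derivative (f \<circ> inv_into U \<phi>) (at (\<phi> q))"
  have inv_q: "inv_into U \<phi> (\<phi> q) = q"
    using smooth_atlas_chartD(5)[OF \<A> c] q by simp
  have lincomb: "?D (\<lambda>y. a * f y + b * h y) v = a * ?D f v + b * ?D h v"
    if f: "smooth_map \<A> f" and h: "smooth_map \<A> h" for f h :: "'m \<Rightarrow> real" and a b v
  proof -
    have "((\<lambda>x. a * (f \<circ> inv_into U \<phi>) x + b * (h \<circ> inv_into U \<phi>) x) has_derivative
        (\<lambda>v. a * ?D f v + b * ?D h v)) (at (\<phi> q))"
      by (intro has_derivative_add has_derivative_mult_right smooth_map_has_derivative[OF _ c q] f h)
    then have "((\<lambda>y. a * f y + b * h y) \<circ> inv_into U \<phi> has_derivative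
        (\<lambda>v. a * ?D f v + b * ?D h v)) (at (\<phi> q))"
      by (simp only: o_def)
    from frechet_derivative_at[OF this, symmetric] show ?thesis by (simp only:)
  qed
  have mult: "?D (\<lambda>y. f y * h y) v = f q * ?D h v + h q * ?D f v"
    if f: "smooth_map \<A> f" and h: "smooth_map \<A> h" for f h :: "'m \<Rightarrow> real" and v
  proof -
    have "((\<lambda>x. (f \<circ> inv_into U \<phi>) x * (h \<circ> inv_into U \<phi>) x) has_derivative
        (\<lambda>v. (f \<circ> inv_into U \<phi>) (\<phi> q) * ?D h v + ?D f v * (h \<circ> inv_into U \<phi>) (\<phi> q))) (at (\<phi> q))"
      by (intro has_derivative_mult smooth_map_has_derivative[OF _ c q] f h)
    then have "((\<lambda>y. f y * h y) \<circ> inv_into U \<phi> has_derivative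
        (\<lambda>v. f q * ?D h v + ?D f v * h q)) (at (\<phi> q))"
      by (simp only: o_def inv_q)
    from frechet_derivative_at[OF this, symmetric] show ?thesis by (simp only: mult.commute)
  qed
  show ?thesis
    using lincomb mult smooth_map_lincomb[OF \<A>] smooth_map_mult[OF \<A>]
    unfolding tangent_space_def coord_vector_def by auto
qed

text \<open>The chain rule for \<open>f \<circ> \<phi>\<^sup>-\<^sup>1 = (f \<circ> \<psi>\<^sup>-\<^sup>1) \<circ> (\<psi> \<circ> \<phi>\<^sup>-\<^sup>1)\<close>, read in the basis of unit vectors; the
  coefficients are the columns of the Jacobian matrix of the transition map.\<close>

lemma coord_vector_transform:
  fixes \<A> :: "('m::{t2_space, second_countable_topology}, 'd::finite) chart set"
  assumes \<A>: "smooth_atlas \<A>" and c: "(U, \<phi>) \<in> \<A>" and c': "(V, \<psi>) \<in> \<A>" and q: "q \<in> U" "q \<in> V"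
  defines "J \<equiv> matrix (frechet_derivative (\<psi> \<circ> inv_into U \<phi>) (at (\<phi> q)))"
  shows "coord_vector \<A> (U, \<phi>) i q = (\<lambda>f. \<Sum>j\<in>UNIV. J $ j $ i * coord_vector \<A> (V, \<psi>) j q f)"
proof
  fix f :: "'m \<Rightarrow> real"
  let ?T = "\<psi> \<circ> inv_into U \<phi>"
  show "coord_vector \<A> (U, \<phi>) i q f = (\<Sum>j\<in>UNIV. J $ j $ i * coord_vector \<A> (V, \<psi>) j q f)"
  proof (cases "smooth_map \<A> f")
    case True
    have [simp]: "inv_into U \<phi> (\<phi> p) = p" if "p \<in> U" for p
      using smooth_atlas_chartD(5)[OF \<A> c] that by simp
    have [simp]: "inv_into V \<psi> (\<psi> p) = p" if "p \<in> V" for p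
      using smooth_atlas_chartD(5)[OF \<A> c'] that by simp
    have UV: "open (\<phi> ` (U \<inter> V))" "\<phi> q \<in> \<phi> ` (U \<inter> V)"
      using q smooth_atlas_chartD(1)[OF \<A> c] smooth_atlas_chartD(1)[OF \<A> c']
      by (auto intro!: chart_image_open[OF \<A> c])
    have T: "(?T has_derivative frechet_derivative ?T (at (\<phi> q))) (at (\<phi> q))"
      using smooth_on_differentiable[OF smooth_atlas_transition[OF \<A> c c'] UV(2)]
      by (simp add: frechet_derivative_works)
    define L where "L = frechet_derivative (f \<circ> inv_into V \<psi>) (at (\<psi> q))"
    have f: "(f \<circ> inv_into V \<psi> has_derivative L) (at (?T (\<phi> q)))"
      using smooth_map_has_derivative[OF True c' q(2)] q by (simp add: L_def)
    have "(f \<circ> inv_into U \<phi> has_derivative L \<circ> frechet_derivative ?T (at (\<phi> q))) (at (\<phi> q))"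
      by (rule has_derivative_transform_within_open[OF diff_chain_at[OF T f] UV]) auto
    then have "frechet_derivative (f \<circ> inv_into U \<phi>) (at (\<phi> q)) (axis i 1)
        = L (frechet_derivative ?T (at (\<phi> q)) (axis i 1))"
      by (metis frechet_derivative_at o_apply)
    also have "frechet_derivative ?T (at (\<phi> q)) (axis i 1) = (\<Sum>j\<in>UNIV. J $ j $ i *\<^sub>R axis j 1)"
      by (simp add: J_def matrix_def vec_eq_iff axis_def if_distrib cong: if_cong)
    also have "L \<dots> = (\<Sum>j\<in>UNIV. J $ j $ i * L (axis j 1))"
    proof -
      have "linear L" using f has_derivative_linear by blast
      then show ?thesis by (simp add: linear_sum linear_cmul)
    qed
    finally show ?thesis
      using True by (simp only: coord_vector_def L_def prod.case if_True)
  qed (simp add: coord_vector_def)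
qed

text \<open>Bilinearity of a metric is only known on tangent vectors, so moving a sum out of its arguments
  requires that partial sums remain in the tangent space.\<close>

lemma tangent_space_lincomb:
  assumes "X \<in> tangent_space \<A> q" "Y \<in> tangent_space \<A> q"
  shows "(\<lambda>f. a * X f + b * Y f) \<in> tangent_space \<A> q"
  using assms unfolding tangent_space_def by (auto simp: algebra_simps)

lemma tangent_space_sum:
  assumes "finite F" "\<And>j. Y j \<in> tangent_space \<A> q"
  shows "(\<lambda>f. \<Sum>j\<in>F. a j * Y j f) \<in> tangent_space \<A> q"
  using assms(1)
proof (induction F)
  case empty
  then show ?case using tangent_space_lincomb[OF assms(2) assms(2), of 0 _ 0] by simp
next
  case (insert j F)
  then show ?case using tangent_space_lincomb[OF assms(2) insert.IH, of "a j" j 1] by simp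
qed

lemma inner_product_sum_left:
  assumes B: "inner_product_on_tangent (tangent_space \<A> q) B"
    and "finite F" "\<And>j. Y j \<in> tangent_space \<A> q" "Z \<in> tangent_space \<A> q"
  shows "B (\<lambda>f. \<Sum>j\<in>F. a j * Y j f) Z = (\<Sum>j\<in>F. a j * B (Y j) Z)"
  using assms(2)
proof (induction F)
  have lin: "B (\<lambda>f. a * X f + b * Y f) Z = a * B X Z + b * B Y Z"
    if "X \<in> tangent_space \<A> q" "Y \<in> tangent_space \<A> q" for X Y a b
    using B that assms(4) by (auto simp: inner_product_on_tangent_def)
  {
    case empty
    show ?case using lin[OF assms(3) assms(3), of 0 _ 0] by simp
  next
    case (insert j F)
    then show ?case
      using lin[OF assms(3) tangent_space_sum[OF insert(1) assms(3)], of "a j" j 1] by simp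
  }
qed

lemma inner_product_sum_right:
  assumes B: "inner_product_on_tangent (tangent_space \<A> q) B"
    and "finite F" "\<And>j. Y j \<in> tangent_space \<A> q" "Z \<in> tangent_space \<A> q"
  shows "B Z (\<lambda>f. \<Sum>j\<in>F. a j * Y j f) = (\<Sum>j\<in>F. a j * B Z (Y j))"
proof -
  have sym: "B X Y = B Y X" if "X \<in> tangent_space \<A> q" "Y \<in> tangent_space \<A> q" for X Y
    using B that by (auto simp: inner_product_on_tangent_def)
  have "B Z (\<lambda>f. \<Sum>j\<in>F. a j * Y j f) = B (\<lambda>f. \<Sum>j\<in>F. a j * Y j f) Z"
    using assms by (intro sym tangent_space_sum)
  then show ?thesis
    using inner_product_sum_left[OF assms] assms(3,4) by (simp add: sym)
qed

lemma gram_matrix_transform: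
  fixes \<A> :: "('m::{t2_space, second_countable_topology}, 'd::finite) chart set"
  assumes \<A>: "smooth_atlas \<A>" and c: "(U, \<phi>) \<in> \<A>" and c': "(V, \<psi>) \<in> \<A>" and q: "q \<in> U" "q \<in> V"
    and g: "inner_product_on_tangent (tangent_space \<A> q) (g q)"
  defines "J \<equiv> matrix (frechet_derivative (\<psi> \<circ> inv_into U \<phi>) (at (\<phi> q)))"
  shows "gram_matrix \<A> g (U, \<phi>) q = transpose J ** gram_matrix \<A> g (V, \<psi>) q ** J"
proof -
  let ?Y = "\<lambda>j. coord_vector \<A> (V, \<psi>) j q"
  have Y: "?Y j \<in> tangent_space \<A> q" for j
    by (rule coord_vector_in_tangent_space[OF \<A> c' q(2)])
  have "g q (coord_vector \<A> (U, \<phi>) i q) (coord_vector \<A> (U, \<phi>) k q) =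
      (\<Sum>l\<in>UNIV. (\<Sum>j\<in>UNIV. J $ j $ i * g q (?Y j) (?Y l)) * J $ l $ k)" for i k
  proof -
    let ?X = "\<lambda>i f. \<Sum>j\<in>UNIV. J $ j $ i * ?Y j f"
    have "g q (coord_vector \<A> (U, \<phi>) i q) (coord_vector \<A> (U, \<phi>) k q) = g q (?X i) (?X k)"
      unfolding J_def by (simp only: coord_vector_transform[OF \<A> c c' q])
    also have "\<dots> = (\<Sum>j\<in>UNIV. J $ j $ i * g q (?Y j) (?X k))"
      by (rule inner_product_sum_left[OF g]) (auto intro: Y tangent_space_sum)
    also have "\<dots> = (\<Sum>j\<in>UNIV. J $ j $ i * (\<Sum>l\<in>UNIV. J $ l $ k * g q (?Y j) (?Y l)))"
      by (subst inner_product_sum_right[OF g]) (auto intro: Y)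
    also have "\<dots> = (\<Sum>j\<in>UNIV. \<Sum>l\<in>UNIV. J $ j $ i * g q (?Y j) (?Y l) * J $ l $ k)"
      by (simp add: sum_distrib_left ac_simps)
    also have "\<dots> = (\<Sum>l\<in>UNIV. \<Sum>j\<in>UNIV. J $ j $ i * g q (?Y j) (?Y l) * J $ l $ k)"
      by (rule sum.swap)
    finally show ?thesis
      by (simp only: sum_distrib_right)
  qed
  then show ?thesis
    by (simp add: gram_matrix_def matrix_matrix_mult_def transpose_def vec_eq_iff)
qed

corollary sqrt_det_gram_matrix_transform:
  fixes \<A> :: "('m::{t2_space, second_countable_topology}, 'd::finite) chart set"
  assumes "smooth_atlas \<A>" "(U, \<phi>) \<in> \<A>" "(V, \<psi>) \<in> \<A>" "q \<in> U" "q \<in> V"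
    and "inner_product_on_tangent (tangent_space \<A> q) (g q)"
  shows "sqrt (det (gram_matrix \<A> g (U, \<phi>) q)) =
    \<bar>det (matrix (frechet_derivative (\<psi> \<circ> inv_into U \<phi>) (at (\<phi> q))))\<bar> *
    sqrt (det (gram_matrix \<A> g (V, \<psi>) q))"
proof -
  let ?J = "matrix (frechet_derivative (\<psi> \<circ> inv_into U \<phi>) (at (\<phi> q)))"
  have "det (gram_matrix \<A> g (U, \<phi>) q) = det ?J * det ?J * det (gram_matrix \<A> g (V, \<psi>) q)"
    by (simp add: gram_matrix_transform[OF assms(1-5), of g, OF assms(6)] det_mul)
  then show ?thesis
    \<comment> \<open>\<open>sqrt\<close> is odd and multiplicative on all reals, so this covers determinants of either sign.\<close>
    by (simp only: real_sqrt_mult real_sqrt_mult_self real_sqrt_abs2)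
qed

section \<open>Riemannian volume\<close>

lemma chart_image_borel:
  assumes "smooth_atlas \<A>" "(U, \<phi>) \<in> \<A>" "S \<in> sets borel" "S \<subseteq> U"
  shows "\<phi> ` S \<in> sets borel"
proof -
  note c = smooth_atlas_chartD[OF assms(1,2)]
  have "\<phi> ` S = inv_into U \<phi> -` S \<inter> space (restrict_space borel (\<phi> ` U))"
    using assms(4) c(5) by (auto simp: space_restrict_space subset_iff)
  also have "\<dots> \<in> sets (restrict_space borel (\<phi> ` U))"
    by (rule measurable_sets[OF borel_measurable_continuous_on_restrict[OF c(4)] assms(3)])
  finally show ?thesis
    using c(2) by (auto simp: sets_restrict_space_iff)
qed

definition volume_density ::
  "('m::topological_space, 'd::finite) chart set \<Rightarrow> 'm metric \<Rightarrow> ('m, 'd) chart \<Rightarrow> real ^ 'd \<Rightarrow> real" where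
  "volume_density \<A> g c x = sqrt (det (gram_matrix \<A> g c (inv_into (fst c) (snd c) x)))"

definition chart_volume ::
  "('m::topological_space, 'd::finite) chart set \<Rightarrow> 'm metric \<Rightarrow> ('m, 'd) chart \<Rightarrow> 'm set \<Rightarrow> ennreal" where
  "chart_volume \<A> g c S =
     (\<integral>\<^sup>+ x. ennreal (volume_density \<A> g c x) * indicator (snd c ` S) x \<partial>lborel)"

lemma continuous_on_volume_density:
  assumes "C2_riemannian_metric \<A> g" "(U, \<phi>) \<in> \<A>"
  shows "continuous_on (\<phi> ` U) (volume_density \<A> g (U, \<phi>))"
proof -
  have "Ck_on (Suc (Suc 0)) (\<phi> ` U) (\<lambda>x. gram_matrix \<A> g (U, \<phi>) (inv_into U \<phi> x) $ i $ j)" for i j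
    using assms unfolding C2_riemannian_metric_def numeral_2_eq_2 by blast
  then have "continuous_on (\<phi> ` U) (\<lambda>x. gram_matrix \<A> g (U, \<phi>) (inv_into U \<phi> x) $ i $ j)" for i j
    using Ck_on_SucD Ck_on.simps(1) by blast
  then show ?thesis
    unfolding volume_density_def det_def fst_conv snd_conv
    by (intro continuous_on_real_sqrt continuous_on_sum continuous_on_mult continuous_on_const continuous_on_prod)
qed

lemma volume_density_measurable:
  assumes \<A>: "smooth_atlas \<A>" and g: "C2_riemannian_metric \<A> g" and c: "(U, \<phi>) \<in> \<A>"
    and S: "S \<in> sets borel" "S \<subseteq> U"
  shows "(\<lambda>x. indicator (\<phi> ` S) x * volume_density \<A> g (U, \<phi>) x) \<in> borel_measurable borel"
  using borel_measurable_continuous_on_indicator[OF chart_image_borel[OF \<A> c S]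
      continuous_on_subset[OF continuous_on_volume_density[OF g c] image_mono[OF S(2)]]]
  by simp

text \<open>The weight \<open>sqrt (det G)\<close> transforms by exactly the factor \<open>\<bar>det J\<bar>\<close> that the change of variables
  along the transition map introduces.\<close>

lemma chart_volume_compatible:
  fixes \<A> :: "('m::{t2_space, second_countable_topology}, 'd::finite) chart set"
  assumes \<A>: "smooth_atlas \<A>" and g: "C2_riemannian_metric \<A> g"
    and c: "(U, \<phi>) \<in> \<A>" and c': "(V, \<psi>) \<in> \<A>"
    and S: "S \<in> sets borel" "S \<subseteq> U" "S \<subseteq> V"
  shows "chart_volume \<A> g (U, \<phi>) S = chart_volume \<A> g (V, \<psi>) S"
proof -
  let ?T = "\<psi> \<circ> inv_into U \<phi>"
  have [simp]: "inv_into U \<phi> (\<phi> p) = p" if "p \<in> S" for p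
    using smooth_atlas_chartD(5)[OF \<A> c] that S by auto
  have [simp]: "inv_into V \<psi> (\<psi> p) = p" if "p \<in> S" for p
    using smooth_atlas_chartD(5)[OF \<A> c'] that S by auto
  have image: "?T ` (\<phi> ` S) = \<psi> ` S"
    by (auto simp: image_image)
  have "(\<integral>\<^sup>+ y. ennreal (volume_density \<A> g (V, \<psi>) y) * indicator (?T ` (\<phi> ` S)) y \<partial>lborel) =
        (\<integral>\<^sup>+ x. ennreal (volume_density \<A> g (U, \<phi>) x) * indicator (\<phi> ` S) x \<partial>lborel)"
  proof (rule nn_integral_change_of_variables[where T' = "\<lambda>x. frechet_derivative ?T (at x)"])
    show "\<phi> ` S \<in> sets borel"
      by (rule chart_image_borel[OF \<A> c S(1,2)])
    show "(?T has_derivative frechet_derivative ?T (at x)) (at x within \<phi> ` S)" if "x \<in> \<phi> ` S" for x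
    proof -
      have "x \<in> \<phi> ` (U \<inter> V)" using that S by auto
      then show ?thesis
        using smooth_on_differentiable[OF smooth_atlas_transition[OF \<A> c c']]
        unfolding frechet_derivative_works by (blast intro: has_derivative_at_withinI)
    qed
    show "inj_on ?T (\<phi> ` S)"
      using smooth_atlas_chartD(5)[OF \<A> c'] S by (auto simp: inj_on_def subset_iff)
    show "volume_density \<A> g (U, \<phi>) x =
        \<bar>det (matrix (frechet_derivative ?T (at x)))\<bar> * volume_density \<A> g (V, \<psi>) (?T x)"
      if x: "x \<in> \<phi> ` S" for x
    proof -
      obtain q where q: "x = \<phi> q" "q \<in> S" using x by auto
      then have "q \<in> U" "q \<in> V" using S by auto
      moreover have "inner_product_on_tangent (tangent_space \<A> q) (g q)"
        using g by (auto simp: C2_riemannian_metric_def)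
      ultimately show ?thesis
        using sqrt_det_gram_matrix_transform[OF \<A> c c', of q g] q by (simp add: volume_density_def)
    qed
    show "(\<lambda>y. indicator (?T ` (\<phi> ` S)) y * volume_density \<A> g (V, \<psi>) y) \<in> borel_measurable borel"
      unfolding image by (rule volume_density_measurable[OF \<A> g c' S(1,3)])
    show "(\<lambda>x. indicator (\<phi> ` S) x * volume_density \<A> g (U, \<phi>) x) \<in> borel_measurable borel"
      by (rule volume_density_measurable[OF \<A> g c S(1,2)])
  qed
  then show ?thesis
    unfolding image by (simp add: chart_volume_def)
qed

definition is_riemannian_volume ::
  "('m::topological_space, 'd::finite) chart set \<Rightarrow> 'm metric \<Rightarrow> 'm measure \<Rightarrow> bool" where
  "is_riemannian_volume \<A> g \<mu> \<longleftrightarrow> sets \<mu> = sets borel \<and>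
     (\<forall>c\<in>\<A>. \<forall>S\<in>sets borel. S \<subseteq> fst c \<longrightarrow> emeasure \<mu> S = chart_volume \<A> g c S)"

text \<open>Second countability yields countably many charts that cover the manifold; removing from each the
  union of the earlier ones makes the pieces disjoint.\<close>

lemma countable_chart_partition:
  fixes \<A> :: "('m::{t2_space, second_countable_topology}, 'd::finite) chart set"
  assumes \<A>: "smooth_atlas \<A>"
  obtains c :: "nat \<Rightarrow> ('m, 'd) chart" and D :: "nat \<Rightarrow> 'm set"
  where "\<And>n. c n \<in> \<A>" "\<And>n. D n \<in> sets borel" "\<And>n. D n \<subseteq> fst (c n)"
    "disjoint_family D" "(\<Union>n. D n) = UNIV"
proof -
  have op: "open (fst c)" if "c \<in> \<A>" for c
    using smooth_atlas_chartD(1)[OF \<A>, of "fst c" "snd c"] that by simp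
  obtain F where F: "F \<subseteq> fst ` \<A>" "countable F" "\<Union>F = UNIV"
    using Lindelof[of "fst ` \<A>"] op smooth_atlas_cover[OF \<A>] by (metis imageE)
  then have "F \<noteq> {}" by auto
  have "\<exists>c\<in>\<A>. fst c = from_nat_into F n" for n
    using from_nat_into[OF \<open>F \<noteq> {}\<close>, of n] F(1) by (metis imageE subsetD)
  then obtain c where c: "\<And>n. c n \<in> \<A>" "\<And>n. fst (c n) = from_nat_into F n"
    by metis
  have union: "(\<Union>n. fst (c n)) = UNIV"
    using F(3) range_from_nat_into[OF \<open>F \<noteq> {}\<close> F(2)] by (simp add: c)
  show thesis
  proof (rule that[of c "disjointed (\<lambda>n. fst (c n))"])
    have "range (disjointed (\<lambda>n. fst (c n))) \<subseteq> sets borel"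
      using op[OF c(1)] by (intro sets.range_disjointed_sets) (auto simp only: borel_open)
    then show "disjointed (\<lambda>n. fst (c n)) n \<in> sets borel" for n by auto
    show "disjointed (\<lambda>n. fst (c n)) n \<subseteq> fst (c n)" for n
      by (rule disjointed_subset)
  qed (use c union in \<open>auto simp: UN_disjointed_eq disjoint_family_disjointed\<close>)
qed

lemma chart_volume_suminf:
  assumes \<A>: "smooth_atlas \<A>" and g: "C2_riemannian_metric \<A> g" and c: "c \<in> \<A>"
    and S: "\<And>n. S n \<in> sets borel" "\<And>n. S n \<subseteq> fst c" and disj: "disjoint_family S"
  shows "chart_volume \<A> g c (\<Union>n. S n) = (\<Sum>n. chart_volume \<A> g c (S n))"
proof -
  obtain U \<phi> where c_eq: "c = (U, \<phi>)" by fastforce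
  let ?w = "volume_density \<A> g (U, \<phi>)"
  have SU: "S n \<subseteq> U" for n using S(2) c_eq by simp
  have inj: "inj_on \<phi> U" using smooth_atlas_chartD(5)[OF \<A>] c c_eq by blast
  have disj': "disjoint_family (\<lambda>n. \<phi> ` S n)"
    unfolding disjoint_family_on_def
  proof safe
    fix i j x y assume "i \<noteq> j" "x \<in> S i" "y \<in> S j" "\<phi> x = \<phi> y"
    moreover from this have "x = y" using inj SU by (meson inj_onD subsetD)
    ultimately show "\<phi> x \<in> {}" using disj by (auto simp: disjoint_family_on_def)
  qed
  have meas: "(\<lambda>x. ennreal (?w x) * indicator (\<phi> ` S n) x) \<in> borel_measurable lborel" for n
  proof -
    have "(\<lambda>x. ennreal (indicator (\<phi> ` S n) x * ?w x)) \<in> borel_measurable borel"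
      using volume_density_measurable[OF \<A> g c[unfolded c_eq] S(1) SU] by measurable
    also have "(\<lambda>x. ennreal (indicator (\<phi> ` S n) x * ?w x)) = (\<lambda>x. ennreal (?w x) * indicator (\<phi> ` S n) x)"
      by (auto simp: indicator_def)
    finally show ?thesis by simp
  qed
  have "chart_volume \<A> g c (\<Union>n. S n) = (\<integral>\<^sup>+ x. (\<Sum>n. ennreal (?w x) * indicator (\<phi> ` S n) x) \<partial>lborel)"
    unfolding chart_volume_def c_eq snd_conv image_UN
    by (simp add: suminf_indicator[OF disj', symmetric])
  also have "\<dots> = (\<Sum>n. \<integral>\<^sup>+ x. ennreal (?w x) * indicator (\<phi> ` S n) x \<partial>lborel)"
    by (rule nn_integral_suminf[OF meas])
  finally show ?thesis by (simp add: chart_volume_def c_eq)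
qed

text \<open>The measure of \<open>S\<close> is the sum of the chart volumes of its parts in a countable partition subordinate
  to charts. In an arbitrary chart, compatibility allows each part to be measured in that chart
  instead, and the parts then add up to the chart volume of \<open>S\<close>.\<close>

lemma ex_riemannian_volume:
  fixes \<A> :: "('m::{t2_space, second_countable_topology}, 'd::finite) chart set"
  assumes \<A>: "smooth_atlas \<A>" and g: "C2_riemannian_metric \<A> g"
  shows "\<exists>\<mu>. is_riemannian_volume \<A> g \<mu>"
proof -
  obtain c :: "nat \<Rightarrow> ('m, 'd) chart" and D :: "nat \<Rightarrow> 'm set"
    where cD: "\<And>n. c n \<in> \<A>" "\<And>n. D n \<in> sets borel" "\<And>n. D n \<subseteq> fst (c n)"
      "disjoint_family D" "(\<Union>n. D n) = UNIV"
    using countable_chart_partition[OF \<A>] by blast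
  have disj: "disjoint_family (\<lambda>n. S \<inter> D n)" for S
    using cD(4) unfolding disjoint_family_on_def by blast
  define m where "m S = (\<Sum>n. chart_volume \<A> g (c n) (S \<inter> D n))" for S
  define \<mu> where "\<mu> = measure_of UNIV (sets borel) m"
  have sets: "sets \<mu> = sets borel"
    unfolding \<mu>_def using sets.sigma_sets_eq[of borel] by (simp add: sets_measure_of)
  have emeasure: "emeasure \<mu> S = m S" if "S \<in> sets borel" for S
  proof (rule emeasure_measure_of[OF \<mu>_def])
    show "positive (sets \<mu>) m"
      by (simp add: positive_def m_def chart_volume_def)
    show "countably_additive (sets \<mu>) m"
    proof (rule countably_additiveI)
      fix S :: "nat \<Rightarrow> 'm set"
      assume S: "range S \<subseteq> sets \<mu>" "disjoint_family S"
      have "m (\<Union>i. S i) = (\<Sum>n. chart_volume \<A> g (c n) (\<Union>i. S i \<inter> D n))"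
        by (simp add: m_def)
      also have "\<dots> = (\<Sum>n. \<Sum>i. chart_volume \<A> g (c n) (S i \<inter> D n))"
      proof (rule suminf_cong, rule chart_volume_suminf[OF \<A> g cD(1)])
        show "S i \<inter> D n \<in> sets borel" for i n
          using S(1) cD(2) by (auto simp: sets)
        show "S i \<inter> D n \<subseteq> fst (c n)" for i n
          using cD(3) by blast
        show "disjoint_family (\<lambda>i. S i \<inter> D n)" for n
          using S(2) by (auto simp: disjoint_family_on_def)
      qed
      also have "\<dots> = (\<Sum>i. \<Sum>n. chart_volume \<A> g (c n) (S i \<inter> D n))"
        \<comment> \<open>The sums are exchanged by viewing the outer one as an integral over the counting measure.\<close>
        using nn_integral_suminf[of "\<lambda>i n. chart_volume \<A> g (c n) (S i \<inter> D n)" "count_space UNIV"]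
        by (simp add: nn_integral_count_space_nat)
      finally show "(\<Sum>i. m (S i)) = m (\<Union>i. S i)"
        by (simp add: m_def)
    qed
  qed (use that sets in auto)
  have "emeasure \<mu> S = chart_volume \<A> g d S"
    if d: "d \<in> \<A>" and S: "S \<in> sets borel" "S \<subseteq> fst d" for d S
  proof -
    have "m S = (\<Sum>n. chart_volume \<A> g d (S \<inter> D n))"
      unfolding m_def
    proof (rule suminf_cong)
      fix n
      have "S \<inter> D n \<in> sets borel" "S \<inter> D n \<subseteq> fst (c n)" "S \<inter> D n \<subseteq> fst d"
        using S cD(2,3) by blast+
      then show "chart_volume \<A> g (c n) (S \<inter> D n) = chart_volume \<A> g d (S \<inter> D n)"
        using chart_volume_compatible[OF \<A> g, of "fst (c n)" "snd (c n)" "fst d" "snd d"] cD(1) d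
        by simp
    qed
    also have "\<dots> = chart_volume \<A> g d (\<Union>n. S \<inter> D n)"
      using S cD(2) by (intro chart_volume_suminf[OF \<A> g d, symmetric] disj) auto
    also have "(\<Union>n. S \<inter> D n) = S"
      using cD(5) by auto
    finally show ?thesis using emeasure[OF S(1)] by simp
  qed
  then show ?thesis
    using sets by (auto simp: is_riemannian_volume_def)
qed

lemma riemannian_volume_unique:
  fixes \<A> :: "('m::{t2_space, second_countable_topology}, 'd::finite) chart set"
  assumes \<A>: "smooth_atlas \<A>"
    and \<mu>: "is_riemannian_volume \<A> g \<mu>" and \<nu>: "is_riemannian_volume \<A> g \<nu>"
  shows "\<mu> = \<nu>"
proof (rule measure_eqI)
  obtain c :: "nat \<Rightarrow> ('m, 'd) chart" and D :: "nat \<Rightarrow> 'm set"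
    where cD: "\<And>n. c n \<in> \<A>" "\<And>n. D n \<in> sets borel" "\<And>n. D n \<subseteq> fst (c n)"
      "disjoint_family D" "(\<Union>n. D n) = UNIV"
    using countable_chart_partition[OF \<A>] by blast
  have disj: "disjoint_family (\<lambda>n. S \<inter> D n)" for S
    using cD(4) unfolding disjoint_family_on_def by blast
  show "sets \<mu> = sets \<nu>"
    using \<mu> \<nu> by (simp add: is_riemannian_volume_def)
  fix S assume "S \<in> sets \<mu>"
  then have S: "S \<in> sets borel"
    using \<mu> by (simp add: is_riemannian_volume_def)
  have "emeasure \<eta> S = (\<Sum>n. chart_volume \<A> g (c n) (S \<inter> D n))"
    if \<eta>: "is_riemannian_volume \<A> g \<eta>" for \<eta>
  proof -
    have "emeasure \<eta> S = emeasure \<eta> (\<Union>n. S \<inter> D n)"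
      using cD(5) by (intro arg_cong[where f="emeasure \<eta>"]) auto
    also have "\<dots> = (\<Sum>n. emeasure \<eta> (S \<inter> D n))"
      using \<eta> S cD(2) by (intro suminf_emeasure[symmetric] disj) (auto simp: is_riemannian_volume_def)
    also have "\<dots> = (\<Sum>n. chart_volume \<A> g (c n) (S \<inter> D n))"
    proof (rule suminf_cong)
      fix n
      have "S \<inter> D n \<in> sets borel" "S \<inter> D n \<subseteq> fst (c n)"
        using S cD(2,3) by blast+
      then show "emeasure \<eta> (S \<inter> D n) = chart_volume \<A> g (c n) (S \<inter> D n)"
        using \<eta> cD(1) by (simp add: is_riemannian_volume_def)
    qed
    finally show ?thesis .
  qed
  then show "emeasure \<mu> S = emeasure \<nu> S"
    using \<mu> \<nu> by simp
qed

theorem riemannian_volume_characterization: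
  fixes \<A> :: "('m::{t2_space, second_countable_topology}, 'd::finite) chart set"
  assumes \<A>: "smooth_atlas \<A>" and g: "C2_riemannian_metric \<A> g"
  shows "is_riemannian_volume \<A> g (riemannian_volume \<A> g)"
proof -
  have "riemannian_volume \<A> g = (THE \<mu>. is_riemannian_volume \<A> g \<mu>)"
    unfolding riemannian_volume_def is_riemannian_volume_def chart_volume_def volume_density_def
    by (simp add: case_prod_beta)
  then show ?thesis
    using theI'[of "is_riemannian_volume \<A> g"] ex_riemannian_volume[OF \<A> g]
      riemannian_volume_unique[OF \<A>] by metis
qed

text \<open>Lebesgue measure on a space of positive dimension has no atoms, and \<open>real ^ 'd\<close> always has positive
  dimension since types are inhabited.\<close>

lemma emeasure_riemannian_volume_singleton:
  fixes \<A> :: "('m::{t2_space, second_countable_topology}, 'd::finite) chart set"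
  assumes \<A>: "smooth_atlas \<A>" and \<mu>: "is_riemannian_volume \<A> g \<mu>"
  shows "emeasure \<mu> {q} = 0"
proof -
  obtain c where c: "c \<in> \<A>" "q \<in> fst c"
    using smooth_atlas_cover[OF \<A>] by blast
  then have "emeasure \<mu> {q} = chart_volume \<A> g c {q}"
    using \<mu> by (auto simp: is_riemannian_volume_def)
  also have "\<dots> = 0"
    unfolding chart_volume_def by (intro nn_integral_null_set) auto
  finally show ?thesis .
qed

text \<open>Every point has a neighbourhood of finite volume, the preimage of a coordinate ball on whose
  closure the density is bounded; finitely many of them cover.\<close>

lemma finite_riemannian_volume:
  fixes \<A> :: "('m::{t2_space, second_countable_topology}, 'd::finite) chart set"
  assumes M: "compact (UNIV :: 'm set)" and \<A>: "smooth_atlas \<A>" and g: "C2_riemannian_metric \<A> g"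
    and \<mu>: "is_riemannian_volume \<A> g \<mu>"
  shows "emeasure \<mu> UNIV < \<infinity>"
proof -
  have sets: "sets \<mu> = sets borel"
    using \<mu> by (simp add: is_riemannian_volume_def)
  have finite_near: "\<exists>W. open W \<and> q \<in> W \<and> emeasure \<mu> W < \<infinity>" for q
  proof -
    obtain c where c: "c \<in> \<A>" "q \<in> fst c"
      using smooth_atlas_cover[OF \<A>] by blast
    obtain U \<phi> where c_eq: "c = (U, \<phi>)" by fastforce
    note chart = smooth_atlas_chartD[OF \<A> c(1)[unfolded c_eq]]
    obtain e where e: "e > 0" "cball (\<phi> q) e \<subseteq> \<phi> ` U"
      using chart(2) c(2) c_eq by (auto simp: open_contains_cball)
    define W where "W = U \<inter> \<phi> -` ball (\<phi> q) e"
    have W: "open W" "W \<subseteq> U" "q \<in> W"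
      using continuous_open_preimage[OF chart(3,1)] c(2) e(1) by (auto simp: W_def c_eq)
    have "compact (volume_density \<A> g (U, \<phi>) ` cball (\<phi> q) e)"
      by (intro compact_continuous_image continuous_on_subset[OF continuous_on_volume_density e(2)] g)
        (use c c_eq in auto)
    from bounded_imp_bdd_above[OF compact_imp_bounded[OF this]] obtain B where B: "\<And>x. x \<in> cball (\<phi> q) e \<Longrightarrow> volume_density \<A> g (U, \<phi>) x \<le> B"
      unfolding bdd_above_def by blast
    have "emeasure \<mu> W = chart_volume \<A> g c W"
      using \<mu> W c by (auto simp: is_riemannian_volume_def c_eq)
    also have "\<dots> \<le> (\<integral>\<^sup>+ x. ennreal B * indicator (cball (\<phi> q) e) x \<partial>lborel)"
      unfolding chart_volume_def c_eq snd_conv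
      by (intro nn_integral_mono) (auto simp: W_def indicator_def intro!: ennreal_leI B)
    also have "\<dots> = ennreal B * emeasure lborel (cball (\<phi> q) e)"
      by (subst nn_integral_cmult_indicator) auto
    also have "\<dots> < \<infinity>"
      using emeasure_lborel_cball_finite[of "\<phi> q" e] by (simp add: ennreal_mult_less_top)
    finally show ?thesis using W by blast
  qed
  then obtain W where W: "\<And>q. open (W q)" "\<And>q. q \<in> W q" "\<And>q. emeasure \<mu> (W q) < \<infinity>"
    by metis
  obtain F where F: "finite F" "UNIV = (\<Union>q\<in>F. W q)"
    using compactE_image[OF M, of UNIV W] W by (metis UNIV_I UN_I subset_antisym subset_UNIV subsetI)
  have "emeasure \<mu> UNIV \<le> (\<Sum>q\<in>F. emeasure \<mu> (W q))"
    unfolding F(2) using F(1) W(1) by (intro emeasure_subadditive_finite) (auto simp: sets)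
  also have "\<dots> < \<infinity>"
    using F(1) W(3) by simp
  finally show ?thesis .
qed

section \<open>Recovering a measure from the operator\<close>

lemma borel_measurable_continuous_sets:
  fixes f :: "'a::topological_space \<Rightarrow> 'b::topological_space"
  assumes f: "continuous_on UNIV f" and M: "sets M = sets borel"
  shows "f \<in> borel_measurable M"
  using borel_measurable_continuous_onI[OF f] measurable_cong_sets[OF M refl] by blast

text \<open>For an open set \<open>Q\<close> that misses \<open>x\<^sub>0\<close>, the functions \<open>min 1 (n d)\<close>, with \<open>d\<close> the distance between
  \<open>h\<close> and the compact image of the complement of \<open>Q\<close>, vanish at \<open>x\<^sub>0\<close> and increase to the indicator of
  \<open>Q\<close>. So the measures agree on \<open>Q\<close>. A general open set differs from one that misses \<open>x\<^sub>0\<close> at most by a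
  null set, and finite Borel measures that agree on open sets are equal.\<close>

lemma measure_eq_of_integrals_vanishing_at_point:
  fixes N1 N2 :: "'m::{t2_space, second_countable_topology} measure"
    and h :: "'m \<Rightarrow> 'e::metric_space"
  assumes M: "compact (UNIV :: 'm set)"
    and h: "continuous_on UNIV h" "inj h"
    and fin: "finite_measure N1" "finite_measure N2"
    and sets: "sets N1 = sets borel" "sets N2 = sets borel"
    and null: "emeasure N1 {x0} = 0" "emeasure N2 {x0} = 0"
    and int: "\<And>f :: 'm \<Rightarrow> real. continuous_on UNIV f \<Longrightarrow> f x0 = 0 \<Longrightarrow>
      (\<integral>y. f y \<partial>N1) = (\<integral>y. f y \<partial>N2)"
  shows "N1 = N2"
proof -
  have away: "emeasure N1 Q = emeasure N2 Q" if Q: "open Q" "x0 \<notin> Q" for Q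
  proof -
    define K where "K = h ` (- Q)"
    have K: "closed K" "K \<noteq> {}"
    proof -
      have "compact (- Q)"
        using compact_Int_closed[OF M closed_Compl[OF Q(1)]] by simp
      then show "closed K"
        unfolding K_def using h(1)
        by (intro compact_imp_closed compact_continuous_image) (auto intro: continuous_on_subset)
      \<comment> \<open>Non-emptiness matters because \<open>infdist\<close> to the empty set is zero by convention.\<close>
      show "K \<noteq> {}" using Q(2) by (auto simp: K_def)
    qed
    define d where "d y = infdist (h y) K" for y
    have d0: "d y = 0 \<longleftrightarrow> y \<notin> Q" for y
    proof -
      have "h y \<in> K \<longleftrightarrow> y \<notin> Q" by (simp add: K_def inj_image_mem_iff[OF h(2)])
      then show ?thesis using in_closed_iff_infdist_zero[OF K] by (simp add: d_def)
    qed
    have d_nonneg: "0 \<le> d y" for y by (simp add: d_def infdist_nonneg)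
    have d_cont: "continuous_on UNIV d"
      unfolding d_def by (intro continuous_on_infdist h)
    define f where "f n y = min 1 (real n * d y)" for n y
    have f_cont: "continuous_on UNIV (f n)" for n
      unfolding f_def by (intro continuous_intros d_cont)
    have lim: "(\<lambda>n. f n y) \<longlonglongrightarrow> indicator Q y" for y
    proof (cases "y \<in> Q")
      case True
      then have "d y > 0" using d0 d_nonneg[of y] by (simp add: order_less_le)
      then obtain k :: nat where k: "1 \<le> real k * d y"
        using reals_Archimedean3[of "d y"] less_imp_le by blast
      have "f n y = 1" if "n \<ge> k" for n
      proof -
        have "real k * d y \<le> real n * d y" using that d_nonneg by (intro mult_right_mono) auto
        with k show ?thesis by (simp add: f_def)
      qed
      then show ?thesis
        using True by (intro tendsto_eventually) (auto simp: eventually_sequentially)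
    next
      case False
      then have "d y = 0" by (simp add: d0)
      with False show ?thesis by (simp add: f_def)
    qed
    have conv: "(\<lambda>n. \<integral>y. f n y \<partial>N) \<longlonglongrightarrow> measure N Q"
      if "finite_measure N" "sets N = sets borel" for N
    proof -
      interpret finite_measure N by fact
      have [measurable]: "f n \<in> borel_measurable N" for n
        by (rule borel_measurable_continuous_sets[OF f_cont that(2)])
      have [measurable]: "Q \<in> sets N" using that(2) Q(1) by simp
      have "(\<lambda>n. \<integral>y. f n y \<partial>N) \<longlonglongrightarrow> (\<integral>y. indicator Q y \<partial>N)"
      proof (rule integral_dominated_convergence[where w="\<lambda>_. 1"])
        show "AE y in N. norm (f n y) \<le> 1" for n
          using d_nonneg by (intro AE_I2) (simp add: f_def)
      qed (use lim in simp_all)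
      moreover have "(\<integral>y. indicator Q y \<partial>N) = measure N Q"
        using sets_eq_imp_space_eq[OF that(2)] by simp
      ultimately show ?thesis by simp
    qed
    have "(\<integral>y. f n y \<partial>N1) = (\<integral>y. f n y \<partial>N2)" for n
    proof (rule int[OF f_cont])
      have "d x0 = 0" using Q(2) by (simp add: d0)
      then show "f n x0 = 0" by (simp add: f_def)
    qed
    then have "measure N1 Q = measure N2 Q"
      using LIMSEQ_unique[OF conv[OF fin(1) sets(1)]] conv[OF fin(2) sets(2)] by simp
    then show ?thesis
      using fin by (simp add: finite_measure.emeasure_eq_measure)
  qed
  have eq_open: "emeasure N1 Q = emeasure N2 Q" if Q: "open Q" for Q
  proof -
    have "emeasure N Q = emeasure N (Q - {x0})"
      if "emeasure N {x0} = 0" "sets N = sets borel" for N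
      using that Q by (intro emeasure_Diff_null_set[symmetric]) auto
    then show ?thesis
      using away[of "Q - {x0}"] null sets Q by (simp add: open_Diff)
  qed
  show ?thesis
  proof (rule measure_eqI_generator_eq[where E="{Q. open Q}" and \<Omega>=UNIV and A="\<lambda>_. UNIV"])
    show "Int_stable {Q :: 'm set. open Q}"
      by (auto simp: Int_stable_def)
    show "sets N1 = sigma_sets UNIV {Q. open Q}" "sets N2 = sigma_sets UNIV {Q. open Q}"
      using sets by (simp_all add: borel_def)
    show "emeasure N1 UNIV \<noteq> \<infinity>"
      using fin(1) by (simp add: finite_measure.emeasure_finite)
  qed (use eq_open in auto)
qed

lemma finite_measure_density_continuous:
  fixes q :: "'m::topological_space \<Rightarrow> real"
  assumes M: "compact (UNIV :: 'm set)" and q: "continuous_on UNIV q"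
    and \<mu>: "sets \<mu> = sets borel" "emeasure \<mu> UNIV < \<infinity>"
  shows "finite_measure (density \<mu> (\<lambda>y. ennreal (q y)))"
proof (rule finite_measureI)
  have space: "space \<mu> = UNIV"
    using sets_eq_imp_space_eq[OF \<mu>(1)] by simp
  have "compact (q ` UNIV)"
    by (rule compact_continuous_image[OF q M])
  from bounded_imp_bdd_above[OF compact_imp_bounded[OF this]] obtain B where B: "\<And>y. q y \<le> B"
    unfolding bdd_above_def by blast
  have "q \<in> borel_measurable \<mu>"
    by (rule borel_measurable_continuous_sets[OF q \<mu>(1)])
  then have "emeasure (density \<mu> (\<lambda>y. ennreal (q y))) UNIV = (\<integral>\<^sup>+ y. ennreal (q y) \<partial>\<mu>)"
    using \<mu>(1) by (subst emeasure_density) auto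
  also have "\<dots> \<le> (\<integral>\<^sup>+ y. ennreal B \<partial>\<mu>)"
    by (intro nn_integral_mono ennreal_leI B)
  also have "\<dots> = ennreal B * emeasure \<mu> UNIV"
    by (simp add: space)
  also have "\<dots> < \<infinity>"
    using \<mu>(2) by (simp add: ennreal_mult_less_top)
  finally show "emeasure (density \<mu> (\<lambda>y. ennreal (q y))) (space (density \<mu> (\<lambda>y. ennreal (q y)))) \<noteq> \<infinity>"
    by (simp add: space)
qed

text \<open>At \<open>x\<^sub>0\<close> the difference in the operator becomes \<open>- f x\<^sub>0 + f y = f y\<close> when the operator is applied to
  \<open>- f\<close> with \<open>f x\<^sub>0 = 0\<close>, and the power of \<open>t\<close> cancels the normalisation.\<close>

lemma integral_eq_ext_graph_laplace:
  fixes f q :: "'m::topological_space \<Rightarrow> real"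
  assumes f: "continuous_on UNIV f" "f x0 = 0"
    and p: "continuous_on UNIV p" "\<And>y. 0 < p y" and h: "continuous_on UNIV \<iota>"
    and t: "0 < t"
    and \<mu>: "sets (riemannian_volume \<A> g) = sets borel"
  shows "(\<integral>y. f y \<partial>density (riemannian_volume \<A> g)
            (\<lambda>y. ennreal (exp (- ((norm (\<iota> x0 - \<iota> y))\<^sup>2 / t)) * p y))) =
         t powr (real CARD('d) / 2 + 1) *
           ext_graph_laplace (\<A> :: ('m, 'd::finite) chart set) t p g \<iota> (\<lambda>y. - f y) x0"
proof -
  let ?k = "\<lambda>y. exp (- ((norm (\<iota> x0 - \<iota> y))\<^sup>2 / t))"
  have "continuous_on UNIV (\<lambda>y. ?k y * p y)"
    using t by (intro continuous_intros h p(1)) simp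
  then have q: "(\<lambda>y. ?k y * p y) \<in> borel_measurable (riemannian_volume \<A> g)"
    by (rule borel_measurable_continuous_sets[OF _ \<mu>])
  have "f \<in> borel_measurable (riemannian_volume \<A> g)"
    by (rule borel_measurable_continuous_sets[OF f(1) \<mu>])
  then have "(\<integral>y. f y \<partial>density (riemannian_volume \<A> g) (\<lambda>y. ennreal (?k y * p y))) =
      (\<integral>y. (?k y * p y) *\<^sub>R f y \<partial>riemannian_volume \<A> g)"
    using q less_imp_le[OF p(2)] by (intro integral_density AE_I2) simp_all
  also have "\<dots> = (\<integral>y. ?k y * (- f x0 - - f y) * p y \<partial>riemannian_volume \<A> g)"
    using f(2) by (simp add: ac_simps)
  finally show ?thesis
    using t by (simp add: ext_graph_laplace_def)
qed

theorem theorem3p1: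
  fixes \<A> :: "('m::{t2_space, second_countable_topology}, 'd::finite) chart set"
    and \<iota> :: "'m \<Rightarrow> real ^ 'n"
    and t :: real
    and g1 g2 :: "'m metric"
    and p1 p2 :: "'m \<Rightarrow> real"
  assumes "compact (UNIV :: 'm set)"
    and "smooth_atlas \<A>"
    and "t > 0"
    and "smooth_embedding \<A> \<iota>"
    and "C2_riemannian_metric \<A> g1"
    and "C2_riemannian_metric \<A> g2"
    and "continuous_on UNIV p1" and "\<forall>x. p1 x > 0"
    and "continuous_on UNIV p2" and "\<forall>x. p2 x > 0"
    and "\<forall>f. continuous_on UNIV f \<longrightarrow>
           ext_graph_laplace \<A> t p1 g1 \<iota> f = ext_graph_laplace \<A> t p2 g2 \<iota> f"
  shows "density (riemannian_volume \<A> g1) (\<lambda>y. ennreal (p1 y)) =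
         density (riemannian_volume \<A> g2) (\<lambda>y. ennreal (p2 y))"
proof -
  fix x0 :: 'm
  define k where "k y = exp (- ((norm (\<iota> x0 - \<iota> y))\<^sup>2 / t))" for y
  define N where "N g p = density (riemannian_volume \<A> g) (\<lambda>y. ennreal (k y * p y))"
    for g :: "'m metric" and p
  have \<iota>: "continuous_on UNIV \<iota>" "inj \<iota>"
  proof -
    have "homeomorphic_map euclidean (top_of_set (range \<iota>)) \<iota>"
      using assms(4) by (simp add: smooth_embedding_def embedding_map_def)
    from homeomorphic_imp_continuous_map[OF this] homeomorphic_imp_injective_map[OF this]
    show "continuous_on UNIV \<iota>" "inj \<iota>"
      by (simp_all add: continuous_map_in_subtopology)
  qed
  have k: "continuous_on UNIV k" "k y > 0" for y
    unfolding k_def using assms(3) by (auto intro!: continuous_intros \<iota>)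
  have sets: "sets (riemannian_volume \<A> g) = sets borel" if "C2_riemannian_metric \<A> g" for g
    using riemannian_volume_characterization[OF assms(2) that] by (simp add: is_riemannian_volume_def)
  have meas: "p \<in> borel_measurable (riemannian_volume \<A> g)"
    if "C2_riemannian_metric \<A> g" "continuous_on UNIV p" for g and p :: "'m \<Rightarrow> real"
    by (rule borel_measurable_continuous_sets[OF that(2) sets[OF that(1)]])
  have N: "finite_measure (N g p)" "sets (N g p) = sets borel" "emeasure (N g p) {x0} = 0"
    if g: "C2_riemannian_metric \<A> g" and p: "continuous_on UNIV p" for g p
  proof -
    note vol = riemannian_volume_characterization[OF assms(2) g]
    show "sets (N g p) = sets borel"
      by (simp add: N_def sets[OF g])
    show "finite_measure (N g p)"
      unfolding N_def
      by (intro finite_measure_density_continuous assms(1) continuous_on_mult k p sets[OF g]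
          finite_riemannian_volume[OF assms(1,2) g vol])
    have "(\<lambda>y. ennreal (k y * p y)) \<in> borel_measurable (riemannian_volume \<A> g)"
      using meas[OF g k(1)] meas[OF g p] by measurable
    then have "emeasure (N g p) {x0} =
        (\<integral>\<^sup>+ y. ennreal (k y * p y) * indicator {x0} y \<partial>riemannian_volume \<A> g)"
      unfolding N_def by (intro emeasure_density) (simp_all add: sets[OF g])
    also have "\<dots> = 0"
      using emeasure_riemannian_volume_singleton[OF assms(2) vol] sets[OF g]
      by (intro nn_integral_null_set) auto
    finally show "emeasure (N g p) {x0} = 0" .
  qed
  have "N g1 p1 = N g2 p2"
  proof (rule measure_eq_of_integrals_vanishing_at_point[OF assms(1) \<iota>])
    fix f :: "'m \<Rightarrow> real" assume f: "continuous_on UNIV f" "f x0 = 0"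
    have "ext_graph_laplace \<A> t p1 g1 \<iota> (\<lambda>y. - f y) = ext_graph_laplace \<A> t p2 g2 \<iota> (\<lambda>y. - f y)"
      using assms(11) f(1) by (simp add: continuous_on_minus)
    then show "(\<integral>y. f y \<partial>N g1 p1) = (\<integral>y. f y \<partial>N g2 p2)"
      unfolding N_def k_def
      using integral_eq_ext_graph_laplace[OF f assms(7) _ \<iota>(1) assms(3) sets[OF assms(5)]]
        integral_eq_ext_graph_laplace[OF f assms(9) _ \<iota>(1) assms(3) sets[OF assms(6)]] assms(8,10)
      by simp
  qed (use N assms in auto)
  moreover have "density (N g p) (\<lambda>y. ennreal (1 / k y)) = density (riemannian_volume \<A> g) (\<lambda>y. ennreal (p y))"
    if g: "C2_riemannian_metric \<A> g" and p: "continuous_on UNIV p" "\<forall>y. p y > 0" for g p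
  proof -
    have [measurable]: "k \<in> borel_measurable (riemannian_volume \<A> g)" "p \<in> borel_measurable (riemannian_volume \<A> g)"
      by (intro meas g k p)+
    have "ennreal (k y * p y) * ennreal (1 / k y) = ennreal (p y)" for y
      using k(2)[of y] p(2) by (subst ennreal_mult[symmetric]) (auto intro: less_imp_le)
    then show ?thesis
      unfolding N_def by (subst density_density_eq) auto
  qed
  ultimately show ?thesis
    using assms(5-10) by metis
qed

end
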